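(* Let $n\in\mathbb{N}$, let $\mathcal{F}$ be the set of all functions $[n]\to[n]$, and let $\mathsf{Inv}=(\mathsf{Pre},\mathsf{Dec})$ be a $q$-query adaptive inversion algorithm such that $\Pr_{f\leftarrow\mathcal{F},\,x\leftarrow[n]}[\mathsf{Inv}(f(x);f)\in f^{-1}(f(x))]\ge\alpha$. Let $\mathcal{K}$ be an additive group of size $n$ on the set $[n]$, and for $f_1,f_2\in\mathcal{F}$ let $f_1+f_2$ denote the coordinate-wise sum in $\mathcal{K}$. Assume there exists a two-party protocol $(\mathsf{P}_1,\mathsf{P}_2)$ with communication complexity $k$ such that for every $f_1,f_2\in\mathcal{F}$, the output of $\mathsf{P}_2$ in the execution $(\mathsf{P}_1(f_1),\mathsf{P}_2(f_2))$ equals $\mathsf{Pre}(f_1+f_2)$ with probability at least $1-\gamma$, for some $\gamma\ge0$. Then $k+q\log n\in\Omega(\alpha^2(1-\gamma)\cdot n)$, i.e., there is a constant $c>0$ independent of $n,k,q,\alpha,\gamma$ and the algorithms such that $k+q\log n\ge c\,\alpha^2(1-\gamma)n$.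
   Context: $[n]=\{1,\dots,n\}$; logarithms base 2; $f\leftarrow\mathcal{F}$, $x\leftarrow[n]$ are independent uniform choices; $f^{-1}(y)=\{x: f(x)=y\}$. A $q$-query adaptive inversion algorithm is a pair of deterministic algorithms $(\mathsf{Pre},\mathsf{Dec})$ with $\mathsf{Pre}:\mathcal{F}\to\{0,1\}^s$ (for some $s$) and $\mathsf{Dec}^{(\cdot)}:[n]\times\{0,1\}^s\to[n]$ an oracle algorithm making up to $q$ possibly adaptive oracle queries; $\mathsf{Inv}(y;f):=\mathsf{Dec}^f(y,\mathsf{Pre}(f))$. Functions in $\mathcal{F}$ are identified with vectors in $[n]^n$. The communication complexity of a (possibly randomized) two-party protocol is the maximal number of bits exchanged over all inputs and randomness.
   Formalization: The formal theorem assumes k + q log n > 0 (and α ≥ 0): with k = q = 0, γ = 0, constant Pre and Dec always answering 1, the success probability is at least 1/n, so the claimed bound would read 0 ≥ a positive number; likewise for n = 1, k = 0. *)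

theory Defs
  imports "HOL-Probability.Probability" "HOL-Algebra.Group"
begin

definition funs :: "nat \<Rightarrow> (nat \<Rightarrow> nat) set" where
  "funs n = {1..n} \<rightarrow>\<^sub>E {1..n}"

text \<open>A deterministic oracle algorithm on a fixed input is a decision tree: the next query (or the
  answer) is a function of the oracle's answers to the previous queries.\<close>

datatype oracle_alg = Answer nat | Query nat "nat \<Rightarrow> oracle_alg"

primrec run_oracle :: "(nat \<Rightarrow> nat) \<Rightarrow> oracle_alg \<Rightarrow> nat" where
  "run_oracle f (Answer z) = z"
| "run_oracle f (Query x next) = run_oracle f (next (f x))"

primrec queries :: "(nat \<Rightarrow> nat) \<Rightarrow> oracle_alg \<Rightarrow> nat list" where
  "queries f (Answer z) = []"
| "queries f (Query x next) = x # queries f (next (f x))"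

definition inversion_algorithm ::
  "nat \<Rightarrow> nat \<Rightarrow> nat \<Rightarrow> ((nat \<Rightarrow> nat) \<Rightarrow> bool list) \<Rightarrow> (nat \<Rightarrow> bool list \<Rightarrow> oracle_alg) \<Rightarrow> bool" where
  "inversion_algorithm n s q Pre Dec \<longleftrightarrow>
     (\<forall>f\<in>funs n. length (Pre f) = s) \<and>
     (\<forall>y\<in>{1..n}. \<forall>a. length a = s \<longrightarrow>
        (\<forall>f\<in>funs n. set (queries f (Dec y a)) \<subseteq> {1..n} \<and>
                     length (queries f (Dec y a)) \<le> q \<and>
                     run_oracle f (Dec y a) \<in> {1..n}))"

definition Inv ::
  "((nat \<Rightarrow> nat) \<Rightarrow> bool list) \<Rightarrow> (nat \<Rightarrow> bool list \<Rightarrow> oracle_alg) \<Rightarrow> nat \<Rightarrow> (nat \<Rightarrow> nat) \<Rightarrow> nat" where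
  "Inv Pre Dec y f = run_oracle f (Dec y (Pre f))"

definition preimage :: "nat \<Rightarrow> (nat \<Rightarrow> nat) \<Rightarrow> nat \<Rightarrow> nat set" where
  "preimage n f y = {x \<in> {1..n}. f x = y}"

definition inversion_prob ::
  "nat \<Rightarrow> ((nat \<Rightarrow> nat) \<Rightarrow> bool list) \<Rightarrow> (nat \<Rightarrow> bool list \<Rightarrow> oracle_alg) \<Rightarrow> real" where
  "inversion_prob n Pre Dec =
     measure_pmf.prob (pair_pmf (pmf_of_set (funs n)) (pmf_of_set {1..n}))
       {(f, x). Inv Pre Dec (f x) f \<in> preimage n f (f x)}"

definition fun_sum :: "nat monoid \<Rightarrow> nat \<Rightarrow> (nat \<Rightarrow> nat) \<Rightarrow> (nat \<Rightarrow> nat) \<Rightarrow> (nat \<Rightarrow> nat)" where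
  "fun_sum K n f1 f2 = (\<lambda>x\<in>{1..n}. f1 x \<otimes>\<^bsub>K\<^esub> f2 x)"

text \<open>Two-party protocols as protocol trees (Yao). A node names the party that sends the next bit, so
  a position in the tree is a transcript. At a leaf the second party outputs a function of its
  local data. The types \<open>'a\<close> and \<open>'b\<close> are the local data (input and coins) of the two parties.\<close>

datatype ('a, 'b, 'o) protocol =
    Output2 "'b \<Rightarrow> 'o"
  | Send1 "'a \<Rightarrow> bool" "bool \<Rightarrow> ('a, 'b, 'o) protocol"
  | Send2 "'b \<Rightarrow> bool" "bool \<Rightarrow> ('a, 'b, 'o) protocol"

primrec output2 :: "('a, 'b, 'o) protocol \<Rightarrow> 'a \<Rightarrow> 'b \<Rightarrow> 'o" where
  "output2 (Output2 g) u v = g v"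
| "output2 (Send1 m next) u v = output2 (next (m u)) u v"
| "output2 (Send2 m next) u v = output2 (next (m v)) u v"

primrec bits :: "('a, 'b, 'o) protocol \<Rightarrow> 'a \<Rightarrow> 'b \<Rightarrow> nat" where
  "bits (Output2 g) u v = 0"
| "bits (Send1 m next) u v = Suc (bits (next (m u)) u v)"
| "bits (Send2 m next) u v = Suc (bits (next (m v)) u v)"

text \<open>In a randomized protocol each party has private coins, and both see public coins; the three are
  independent. Purely private-coin and deterministic protocols are the cases where the other
  coins are constant. Coins are natural numbers with an arbitrary distribution, a concrete type,
  so that constants in a bound cannot depend on a type of coins.\<close>

record ('i, 'o) rand_protocol =
  public_coins :: "nat pmf"
  coins1 :: "nat pmf"
  coins2 :: "nat pmf"
  tree :: "(nat \<times> nat \<times> 'i, nat \<times> nat \<times> 'i, 'o) protocol"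

definition coins :: "('i, 'o) rand_protocol \<Rightarrow> (nat \<times> nat \<times> nat) pmf" where
  "coins P = pair_pmf (public_coins P) (pair_pmf (coins1 P) (coins2 P))"

definition exec_output :: "('i, 'o) rand_protocol \<Rightarrow> 'i \<Rightarrow> 'i \<Rightarrow> nat \<times> nat \<times> nat \<Rightarrow> 'o" where
  "exec_output P x1 x2 = (\<lambda>(r, r1, r2). output2 (tree P) (r, r1, x1) (r, r2, x2))"

definition exec_bits :: "('i, 'o) rand_protocol \<Rightarrow> 'i \<Rightarrow> 'i \<Rightarrow> nat \<times> nat \<times> nat \<Rightarrow> nat" where
  "exec_bits P x1 x2 = (\<lambda>(r, r1, r2). bits (tree P) (r, r1, x1) (r, r2, x2))"

definition comm_complexity :: "'i set \<Rightarrow> ('i, 'o) rand_protocol \<Rightarrow> nat" where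
  "comm_complexity X P = Max {exec_bits P x1 x2 w | x1 x2 w. x1 \<in> X \<and> x2 \<in> X \<and> w \<in> set_pmf (coins P)}"

text \<open>The maximum exists, since a protocol tree has finite depth.\<close>

lemma bits_bounded: "\<exists>d. \<forall>u v. bits T u v \<le> d"
proof (induction T)
  case (Output2 g)
  show ?case by simp
next
  case (Send1 m next1)
  from Send1[of "next1 True"] Send1[of "next1 False"] obtain d1 d2
    where d: "\<forall>u v. bits (next1 True) u v \<le> d1" "\<forall>u v. bits (next1 False) u v \<le> d2" by auto
  have "bits (next1 b) u v \<le> max d1 d2" for b u v
    using d by (cases b) (auto simp: le_max_iff_disj)
  then show ?case by (intro exI[of _ "Suc (max d1 d2)"]) auto
next
  case (Send2 m next1)
  from Send2[of "next1 True"] Send2[of "next1 False"] obtain d1 d2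
    where d: "\<forall>u v. bits (next1 True) u v \<le> d1" "\<forall>u v. bits (next1 False) u v \<le> d2" by auto
  have "bits (next1 b) u v \<le> max d1 d2" for b u v
    using d by (cases b) (auto simp: le_max_iff_disj)
  then show ?case by (intro exI[of _ "Suc (max d1 d2)"]) auto
qed

lemma finite_exec_bits:
  "finite {exec_bits P x1 x2 w | x1 x2 w. x1 \<in> X \<and> x2 \<in> X \<and> w \<in> set_pmf (coins P)}"
proof -
  obtain d where "\<forall>u v. bits (tree P) u v \<le> d" using bits_bounded by blast
  then show ?thesis
    by (intro finite_subset[OF _ finite_atMost[of d]]) (auto simp: exec_bits_def)
qed

text \<open>A pitfall for bounds on k + q log n: with constant advice (so k = 0) and no queries (q = 0), the
  algorithm that always answers 1 inverts with probability at least 1/n; for n = 1 this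
  algorithm succeeds always and log n = 0. A positive lower bound can therefore only hold when
  k + q log n > 0.\<close>

end

(* Let the second party, knowing the advice Pre (f1 + f2) from the protocol, run Dec and send each
   query x, to which the first party replies f1 x. For fixed coins this is a deterministic protocol
   whose transcript takes |L| values, ln |L| = O(k + q log n), and whose transcript classes are
   rectangles A x B. For a fixed target y it should output a point i with f1 i + f2 i = y.

   For random f1 in A, the relative entropy of the coordinates of f1 to the uniform distribution sums
   to at most ln (1 / Pr A). Hence, summed over the coordinates i, the squared Hellinger distances by
   which conditioning on f1 i changes the transcript distribution total O(n ln |L|), and similarly
   for f2. By cut-and-paste the transcript barely changes even when f1 i and f2 i are both fixed, so
   the output hits a point of the preimage of y with probability O((1 + ln |L|) / n). Summing over y,
   only O(1 + ln |L|) targets are inverted on average.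

   On the other hand, f1 + f2 is uniform, and by Cauchy-Schwarz against the expected number of
   collisions of a random function, Inv inverts at least alpha^2 n / 2 targets on average, of which
   the protocol keeps a fraction 1 - gamma. *)

theory Submission
  imports Defs
begin

section \<open>Counting in function spaces and Hellinger distances of marginals\<close>

lemma card_PiE_fixed:
  assumes "finite I" "J \<subseteq> I" "u \<in> S"
  shows "card {f \<in> I \<rightarrow>\<^sub>E S. \<forall>j\<in>J. f j = u} * card S ^ card J = card (I \<rightarrow>\<^sub>E S)"
proof -
  have "{f \<in> I \<rightarrow>\<^sub>E S. \<forall>j\<in>J. f j = u} = PiE I (\<lambda>j. if j \<in> J then {u} else S)"
  proof (intro equalityI subsetI)
    fix f assume f: "f \<in> PiE I (\<lambda>j. if j \<in> J then {u} else S)"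
    have "f j \<in> S" if "j \<in> I" for j
      using PiE_mem[OF f that] assms by (auto split: if_splits)
    moreover have "f j = u" if "j \<in> J" for j
      using PiE_mem[OF f, of j] that assms by auto
    ultimately show "f \<in> {f \<in> I \<rightarrow>\<^sub>E S. \<forall>j\<in>J. f j = u}"
      using f by (auto simp: PiE_iff)
  qed (auto simp: PiE_iff)
  then have "card {f \<in> I \<rightarrow>\<^sub>E S. \<forall>j\<in>J. f j = u} = (\<Prod>j\<in>I. card (if j \<in> J then {u} else S))"
    by (simp add: card_PiE assms(1))
  also have "\<dots> = (\<Prod>j\<in>I - J. card S)"
    by (rule prod.mono_neutral_cong_right) (use assms in auto)
  also have "\<dots> = card S ^ card (I - J)" by simp
  finally have "card {f \<in> I \<rightarrow>\<^sub>E S. \<forall>j\<in>J. f j = u} * card S ^ card J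
      = card S ^ (card (I - J) + card J)"
    by (simp add: power_add)
  also have "card (I - J) + card J = card I"
    using assms by (simp add: card_Diff_subset finite_subset card_mono)
  finally show ?thesis using assms by (simp add: card_funcsetE)
qed

lemma sum_card_fibre:
  fixes g :: "'s \<Rightarrow> real"
  assumes "finite A" "finite S" "h ` A \<subseteq> S"
  shows "(\<Sum>u\<in>S. card {f \<in> A. h f = u} * g u) = (\<Sum>f\<in>A. g (h f))"
proof -
  have "(\<Sum>f\<in>A. g (h f)) = (\<Sum>u\<in>S. \<Sum>f\<in>{f \<in> A. h f = u}. g (h f))"
    by (rule sum.group[symmetric]) (use assms in auto)
  then show ?thesis by simp
qed

text \<open>Entropy is subadditive: the marginals of the uniform distribution on \<open>A\<close>
  have total entropy at least \<open>ln (card A)\<close>, so their relative entropies to the uniform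
  distribution on \<open>S\<close> sum to at most the right-hand side. In each coordinate, relative
  entropy dominates the squared Hellinger distance.\<close>

lemma sum_hellinger_marginals_le:
  fixes A :: "('i \<Rightarrow> 's) set"
  assumes fin: "finite I" "finite S" and A: "A \<subseteq> I \<rightarrow>\<^sub>E S" "A \<noteq> {}"
  defines "p \<equiv> \<lambda>i u. real (card {f \<in> A. f i = u}) / card A"
  shows "(\<Sum>i\<in>I. \<Sum>u\<in>S. (sqrt (p i u) - sqrt (1 / card S))\<^sup>2) \<le> ln (card (I \<rightarrow>\<^sub>E S) / card A)"
proof (cases "I = {}")
  case True
  then have "A = {\<lambda>x. undefined}" using A by auto
  then show ?thesis using True by simp
next
  case False
  have finF: "finite (I \<rightarrow>\<^sub>E S)" using fin by (simp add: finite_PiE)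
  have finA: "finite A" using A finF finite_subset by blast
  have cA: "card A > 0" using finA A by (simp add: card_gt_0_iff)
  have img: "(\<lambda>f. f i) ` A \<subseteq> S" if "i \<in> I" for i using A that by (auto simp: PiE_iff)
  have "S \<noteq> {}" using False A by (force simp: PiE_iff)
  then have N: "card S > 0" using fin by (simp add: card_gt_0_iff)
  have p0: "p i u \<ge> 0" for i u by (simp add: p_def)
  have pos: "p i (f i) > 0" if "f \<in> A" for i f
  proof -
    have "card {g \<in> A. g i = f i} > 0" using finA that by (auto simp: card_gt_0_iff)
    then show ?thesis using cA by (simp add: p_def)
  qed
  have p1: "(\<Sum>u\<in>S. p i u) = 1" if "i \<in> I" for i
    using sum_card_fibre[OF finA fin(2) img[OF that], of "\<lambda>_. 1"] cA
    by (simp add: p_def flip: sum_divide_distrib)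
  \<comment> \<open>Gibbs' inequality for the uniform distribution on \<open>A\<close> against the product of its marginals\<close>
  have "(\<Sum>f\<in>A. \<Prod>i\<in>I. p i (f i)) \<le> (\<Sum>f\<in>I \<rightarrow>\<^sub>E S. \<Prod>i\<in>I. p i (f i))"
    by (intro sum_mono2 finF A prod_nonneg ballI p0)
  also have "\<dots> = (\<Prod>i\<in>I. \<Sum>u\<in>S. p i u)"
    using fin by (simp add: prod_sum_PiE)
  also have "\<dots> = 1" by (simp add: p1)
  finally have P1: "(\<Sum>f\<in>A. \<Prod>i\<in>I. p i (f i)) \<le> 1" .
  have "(\<Sum>f\<in>A. ln (card A) + (\<Sum>i\<in>I. ln (p i (f i)))) = (\<Sum>f\<in>A. ln (card A * (\<Prod>i\<in>I. p i (f i))))"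
  proof (rule sum.cong[OF refl])
    fix f assume "f \<in> A"
    then show "ln (card A) + (\<Sum>i\<in>I. ln (p i (f i))) = ln (card A * (\<Prod>i\<in>I. p i (f i)))"
      using cA pos by (subst ln_mult_pos) (auto intro!: prod_pos ln_prod[symmetric] simp: fin less_imp_neq[symmetric])
  qed
  also have "\<dots> \<le> (\<Sum>f\<in>A. card A * (\<Prod>i\<in>I. p i (f i)) - 1)"
    using cA pos by (intro sum_mono ln_le_minus_one) (auto intro!: prod_pos mult_pos_pos)
  also have "\<dots> = card A * (\<Sum>f\<in>A. \<Prod>i\<in>I. p i (f i)) - card A"
    by (simp add: sum_subtractf sum_distrib_left)
  also have "\<dots> \<le> 0" using P1 cA by simp
  finally have g: "card A * ln (card A) + (\<Sum>f\<in>A. \<Sum>i\<in>I. ln (p i (f i))) \<le> 0"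
    by (simp add: sum.distrib)
  have "(\<Sum>f\<in>A. \<Sum>i\<in>I. ln (p i (f i))) = (\<Sum>i\<in>I. \<Sum>f\<in>A. ln (p i (f i)))"
    by (rule sum.swap)
  also have "\<dots> = (\<Sum>i\<in>I. \<Sum>u\<in>S. card {f \<in> A. f i = u} * ln (p i u))"
    by (intro sum.cong refl sum_card_fibre[symmetric] finA fin img)
  also have "\<dots> = card A * (\<Sum>i\<in>I. \<Sum>u\<in>S. p i u * ln (p i u))"
    using cA by (simp add: p_def sum_distrib_left)
  finally have "card A * (ln (card A) + (\<Sum>i\<in>I. \<Sum>u\<in>S. p i u * ln (p i u))) \<le> 0"
    using g by (simp add: ring_distribs)
  then have ent: "ln (card A) + (\<Sum>i\<in>I. \<Sum>u\<in>S. p i u * ln (p i u)) \<le> 0"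
    using cA by (simp add: mult_le_0_iff)
  \<comment> \<open>This is \<open>ln t \<le> t - 1\<close> for the square root \<open>t\<close> of
    the likelihood ratio. The terms \<open>1 / card S - p i u\<close> cancel in the sum over
    \<open>u\<close>, which leaves the relative entropy.\<close>
  have pt: "(sqrt (p i u) - sqrt (1 / card S))\<^sup>2 \<le> p i u * ln (p i u) + p i u * ln (card S) + 1 / card S - p i u"
    for i u
  proof (cases "p i u = 0")
    case False
    then have pp: "p i u > 0" using p0[of i u] by simp
    define t where "t = sqrt (1 / card S) / sqrt (p i u)"
    have t: "t > 0" using pp N by (simp add: t_def)
    have "ln t = - (ln (p i u) + ln (card S)) / 2"
      using pp N by (simp add: t_def ln_div ln_sqrt real_sqrt_divide ln_mult_pos)
    moreover have "ln t \<le> t - 1" using t by (rule ln_le_minus_one)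
    ultimately have "- (ln (p i u) + ln (card S)) \<le> 2 * (t - 1)" by simp
    then have "p i u * - (ln (p i u) + ln (card S)) \<le> p i u * (2 * (t - 1))"
      using pp by (intro mult_left_mono) auto
    moreover have "sqrt (p i u) * sqrt (p i u) = p i u" "sqrt (p i u) * t = sqrt (1 / card S)"
      using pp by (simp_all add: t_def)
    then have "p i u * t = sqrt (p i u) * sqrt (1 / card S)" by (metis mult.assoc)
    ultimately show ?thesis using pp by (simp add: power2_diff algebra_simps)
  qed simp
  have "(\<Sum>i\<in>I. \<Sum>u\<in>S. (sqrt (p i u) - sqrt (1 / card S))\<^sup>2)
      \<le> (\<Sum>i\<in>I. \<Sum>u\<in>S. p i u * ln (p i u) + p i u * ln (card S) + 1 / card S - p i u)"
    by (intro sum_mono pt)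
  also have "\<dots> = (\<Sum>i\<in>I. \<Sum>u\<in>S. p i u * ln (p i u)) + card I * ln (card S)"
    using N by (simp add: sum.distrib sum_subtractf p1 flip: sum_distrib_right)
  also have "\<dots> \<le> card I * ln (card S) - ln (card A)" using ent by simp
  also have "\<dots> = ln (card (I \<rightarrow>\<^sub>E S) / card A)"
    using N cA fin \<open>S \<noteq> {}\<close> by (simp add: card_funcsetE ln_div ln_realpow)
  finally show ?thesis .
qed

text \<open>By Bayes' rule, fixing \<open>f i = u\<close> turns the probability
  \<open>card A / m\<close> of \<open>A\<close> into \<open>card S * (card A / m)\<close> times the
  marginal probability of \<open>u\<close> within \<open>A\<close>. Each square is therefore the
  corresponding one for the marginals, scaled by \<open>card S * (card A / m)\<close>.\<close>

lemma sum_hellinger_fixed_coordinate_le: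
  fixes A :: "('i \<Rightarrow> 's) set"
  assumes fin: "finite I" "finite S" and A: "A \<subseteq> I \<rightarrow>\<^sub>E S"
  defines "m \<equiv> real (card (I \<rightarrow>\<^sub>E S))"
  shows "(\<Sum>i\<in>I. \<Sum>u\<in>S. (sqrt (card S * card {f \<in> A. f i = u} / m) - sqrt (card A / m))\<^sup>2)
    \<le> card S * (card A / m) * ln (m / card A)"
proof (cases "A = {} \<or> S = {}")
  case False
  have finF: "finite (I \<rightarrow>\<^sub>E S)" using fin by (simp add: finite_PiE)
  have cA: "card A > 0" using False finF A finite_subset by (metis card_gt_0_iff)
  have N: "card S > 0" using False fin by (simp add: card_gt_0_iff)
  have m: "m > 0" using N fin by (simp add: m_def card_funcsetE)
  let ?p = "\<lambda>i u. real (card {f \<in> A. f i = u}) / card A"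
  let ?c = "card S * (card A / m)"
  have "(sqrt (card S * card {f \<in> A. f i = u} / m) - sqrt (card A / m))\<^sup>2
      = ?c * (sqrt (?p i u) - sqrt (1 / card S))\<^sup>2" for i u
  proof -
    have h1: "sqrt (card S * card {f \<in> A. f i = u} / m) = sqrt (?c * ?p i u)"
      and h2: "sqrt (card A / m) = sqrt (?c * (1 / card S))"
      using cA N by (simp_all add: field_simps)
    have "sqrt (card S * card {f \<in> A. f i = u} / m) - sqrt (card A / m)
      = sqrt ?c * (sqrt (?p i u) - sqrt (1 / card S))"
      by (subst h1, subst h2) (simp only: real_sqrt_mult right_diff_distrib)
    then show ?thesis using m by (simp add: power_mult_distrib)
  qed
  then have "(\<Sum>i\<in>I. \<Sum>u\<in>S. (sqrt (card S * card {f \<in> A. f i = u} / m) - sqrt (card A / m))\<^sup>2)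
    = ?c * (\<Sum>i\<in>I. \<Sum>u\<in>S. (sqrt (?p i u) - sqrt (1 / card S))\<^sup>2)"
    by (simp add: sum_distrib_left)
  also have "\<dots> \<le> ?c * ln (m / card A)"
    unfolding m_def
    by (intro mult_left_mono sum_hellinger_marginals_le fin A) (use False in auto)
  finally show ?thesis by simp
qed (auto simp: m_def)

section \<open>Rectangular transcripts and planted points\<close>

text \<open>Since \<open>\<surd>(a b) \<cdot> \<surd>(\<alpha> \<beta>) = \<surd>(a \<beta>) \<cdot> \<surd>(\<alpha> b)\<close>, the Hellinger distance between
  \<open>a b\<close> and \<open>\<alpha> \<beta>\<close> equals the one between \<open>a \<beta>\<close> and \<open>\<alpha> b\<close>; the claim is then the triangle inequality.\<close>

lemma cut_and_paste:
  fixes a b \<alpha> \<beta> :: "'l \<Rightarrow> real"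
  assumes nn: "\<And>l. a l \<ge> 0" "\<And>l. b l \<ge> 0" "\<And>l. \<alpha> l \<ge> 0" "\<And>l. \<beta> l \<ge> 0"
    and tot: "(\<Sum>l\<in>L. a l * b l) = 1" "(\<Sum>l\<in>L. \<alpha> l * \<beta> l) = 1"
      "(\<Sum>l\<in>L. a l * \<beta> l) = 1" "(\<Sum>l\<in>L. \<alpha> l * b l) = 1"
  shows "(\<Sum>l\<in>L. b l * (sqrt (a l) - sqrt (\<alpha> l))\<^sup>2)
    \<le> 4 * (\<Sum>l\<in>L. \<beta> l * (sqrt (a l) - sqrt (\<alpha> l))\<^sup>2) + 6 * (\<Sum>l\<in>L. \<alpha> l * (sqrt (b l) - sqrt (\<beta> l))\<^sup>2)"
proof -
  define p where "p l = sqrt (a l) * sqrt (b l)" for l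
  define q where "q l = sqrt (\<alpha> l) * sqrt (\<beta> l)" for l
  define r where "r l = sqrt (\<alpha> l) * sqrt (b l)" for l
  define t where "t l = sqrt (a l) * sqrt (\<beta> l)" for l
  have sq: "(p l)\<^sup>2 = a l * b l" "(q l)\<^sup>2 = \<alpha> l * \<beta> l" "(r l)\<^sup>2 = \<alpha> l * b l" "(t l)\<^sup>2 = a l * \<beta> l" for l
    by (simp_all add: p_def q_def r_def t_def power_mult_distrib nn)
  have cp: "(p l - q l)\<^sup>2 = a l * b l + \<alpha> l * \<beta> l - a l * \<beta> l - \<alpha> l * b l + (t l - r l)\<^sup>2" for l
  proof -
    have "p l * q l = t l * r l" by (simp add: p_def q_def r_def t_def)
    then show ?thesis by (simp add: power2_diff sq)
  qed
  have eq: "(\<Sum>l\<in>L. (p l - q l)\<^sup>2) = (\<Sum>l\<in>L. (t l - r l)\<^sup>2)"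
    by (simp add: cp sum.distrib sum_subtractf tot)
  \<comment> \<open>Used twice below with \<open>q\<close> as the midpoint, which yields the factors
    4 = 2 * 2 and 6 = 2 * 2 + 2.\<close>
  have two: "(x + y)\<^sup>2 \<le> 2 * x\<^sup>2 + 2 * y\<^sup>2" for x y :: real
    using zero_le_power2[of "x - y"] by (simp add: power2_eq_square algebra_simps)
  have "(\<Sum>l\<in>L. b l * (sqrt (a l) - sqrt (\<alpha> l))\<^sup>2) = (\<Sum>l\<in>L. (p l - r l)\<^sup>2)"
    by (intro sum.cong refl) (simp add: p_def r_def nn power_mult_distrib flip: left_diff_distrib)
  also have "\<dots> \<le> (\<Sum>l\<in>L. 2 * (p l - q l)\<^sup>2 + 2 * (q l - r l)\<^sup>2)"
    using two[of "p l - q l" "q l - r l" for l] by (intro sum_mono) simp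
  also have "\<dots> = 2 * (\<Sum>l\<in>L. (t l - r l)\<^sup>2) + 2 * (\<Sum>l\<in>L. (q l - r l)\<^sup>2)"
    by (simp add: sum.distrib eq flip: sum_distrib_left)
  also have "\<dots> \<le> 2 * (\<Sum>l\<in>L. 2 * (t l - q l)\<^sup>2 + 2 * (q l - r l)\<^sup>2) + 2 * (\<Sum>l\<in>L. (q l - r l)\<^sup>2)"
    using two[of "t l - q l" "q l - r l" for l] by (intro add_right_mono mult_left_mono sum_mono) auto
  also have "\<dots> = 4 * (\<Sum>l\<in>L. (t l - q l)\<^sup>2) + 6 * (\<Sum>l\<in>L. (r l - q l)\<^sup>2)"
    by (simp add: sum.distrib power2_commute flip: sum_distrib_left)
  also have "(\<Sum>l\<in>L. (t l - q l)\<^sup>2) = (\<Sum>l\<in>L. \<beta> l * (sqrt (a l) - sqrt (\<alpha> l))\<^sup>2)"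
    by (intro sum.cong refl) (simp add: t_def q_def nn power_mult_distrib flip: left_diff_distrib)
  also have "(\<Sum>l\<in>L. (r l - q l)\<^sup>2) = (\<Sum>l\<in>L. \<alpha> l * (sqrt (b l) - sqrt (\<beta> l))\<^sup>2)"
    by (intro sum.cong refl) (simp add: r_def q_def nn power_mult_distrib flip: right_diff_distrib)
  finally show ?thesis .
qed

text \<open>Gibbs' inequality against the uniform distribution on \<open>L\<close>; the terms
  \<open>1 / card L - p l\<close> of the pointwise bound sum to zero.\<close>

lemma entropy_le_ln_card:
  fixes p :: "'l \<Rightarrow> real"
  assumes "finite L" "L \<noteq> {}" "\<And>l. p l \<ge> 0" "(\<Sum>l\<in>L. p l) = 1"
  shows "(\<Sum>l\<in>L. p l * ln (1 / p l)) \<le> ln (card L)"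
proof -
  have c: "card L > 0" using assms by (simp add: card_gt_0_iff)
  have "p l * ln (1 / p l) \<le> p l * ln (card L) + 1 / card L - p l" for l
  proof (cases "p l = 0")
    case False
    then have pp: "p l > 0" using assms(3)[of l] by simp
    have "ln (1 / (p l * card L)) \<le> 1 / (p l * card L) - 1"
      using pp c by (intro ln_le_minus_one) auto
    then have "p l * ln (1 / (p l * card L)) \<le> p l * (1 / (p l * card L) - 1)"
      using pp by (intro mult_left_mono) auto
    then show ?thesis using pp c by (simp add: ln_div ln_mult_pos algebra_simps)
  qed simp
  then have "(\<Sum>l\<in>L. p l * ln (1 / p l)) \<le> (\<Sum>l\<in>L. p l * ln (card L) + 1 / card L - p l)"
    by (rule sum_mono)
  also have "\<dots> = ln (card L)"
    using c assms(4) by (simp add: sum.distrib sum_subtractf flip: sum_distrib_right)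
  finally show ?thesis .
qed

text \<open>Here \<open>T\<close> plays the transcript, \<open>out\<close> the output, and
  \<open>g i = \<tau> (f i)\<close> says that \<open>f + g\<close> takes the target value at
  \<open>i\<close>. For a typical \<open>i\<close>, fixing both \<open>f i\<close> and
  \<open>g i\<close> hardly changes the distribution of \<open>T\<close>, so \<open>out\<close>
  cannot favour the coordinates where the target value is planted.\<close>

lemma sum_card_planted_le:
  fixes T :: "('i \<Rightarrow> 's) \<Rightarrow> ('i \<Rightarrow> 's) \<Rightarrow> 'l" and out :: "('i \<Rightarrow> 's) \<Rightarrow> ('i \<Rightarrow> 's) \<Rightarrow> 'i"
  assumes fin: "finite I" "finite S" "finite L" and "S \<noteq> {}"
    and \<tau>: "bij_betw \<tau> S S"
  defines "F \<equiv> I \<rightarrow>\<^sub>E S"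
  assumes TL: "\<And>f g. f \<in> F \<Longrightarrow> g \<in> F \<Longrightarrow> T f g \<in> L"
    and rect: "\<And>f1 f2 g1 g2. f1 \<in> F \<Longrightarrow> f2 \<in> F \<Longrightarrow> g1 \<in> F \<Longrightarrow> g2 \<in> F \<Longrightarrow> T f1 f2 = T g1 g2 \<Longrightarrow>
      T f1 g2 = T g1 g2 \<and> out f1 g2 = out g1 g2"
  shows "card S * (\<Sum>i\<in>I. card {z \<in> F \<times> F. snd z i = \<tau> (fst z i) \<and> out (fst z) (snd z) = i})
    \<le> (card F)\<^sup>2 * (2 + 12 * ln (card L))"
proof -
  define N where "N = real (card S)"
  define m where "m = real (card F)"
  have finF: "finite F" using fin by (simp add: finite_PiE F_def)
  have N: "N > 0" using fin \<open>S \<noteq> {}\<close> by (simp add: N_def card_gt_0_iff)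
  have m: "m > 0" using N fin by (simp add: m_def F_def N_def card_funcsetE)
  have "F \<noteq> {}" using m by (auto simp: m_def)
  then have Lne: "L \<noteq> {}" using TL by blast
  define A where "A l = {f \<in> F. \<exists>g\<in>F. T f g = l}" for l
  define B where "B l = {g \<in> F. \<exists>f\<in>F. T f g = l}" for l
  have AF: "A l \<subseteq> F" and BF: "B l \<subseteq> F" for l by (auto simp: A_def B_def)
  have finA: "finite (A l)" and finB: "finite (B l)" for l
    by (rule finite_subset[OF AF finF], rule finite_subset[OF BF finF])
  have Tiff: "T f g = l \<longleftrightarrow> f \<in> A l \<and> g \<in> B l" if "f \<in> F" "g \<in> F" for f g l
  proof
    assume "f \<in> A l \<and> g \<in> B l"
    then obtain f' g' where "g' \<in> F" "T f g' = l" "f' \<in> F" "T f' g = l"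
      by (auto simp: A_def B_def)
    then show "T f g = l" using rect[of f g' f' g] that by simp
  qed (use that in \<open>auto simp: A_def B_def\<close>)
  \<comment> \<open>For fixed \<open>l\<close> the output is a function of the second input alone,
    so the sets \<open>C l i\<close> are disjoint parts of \<open>B l\<close>.\<close>
  define C where "C l i = {g \<in> B l. \<exists>f\<in>A l. out f g = i}" for l i
  have CB: "C l i \<subseteq> B l" for l i by (auto simp: C_def)
  have finC: "finite (C l i)" for l i by (rule finite_subset[OF CB finB])
  have out_unique: "out f g = out f' g" if "f \<in> A l" "f' \<in> A l" "g \<in> B l" for f f' g l
  proof -
    have "f \<in> F" "f' \<in> F" "g \<in> F" using that AF BF by auto
    moreover from this have "T f g = T f' g" using Tiff that by metis
    ultimately show ?thesis using rect by blast
  qed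
  have sumC: "(\<Sum>i\<in>I. card (C l i)) \<le> card (B l)" for l
  proof -
    have "(\<Sum>i\<in>I. card (C l i)) = card (\<Union>i\<in>I. C l i)"
    proof (rule card_UN_disjoint[symmetric])
      show "\<forall>i\<in>I. \<forall>j\<in>I. i \<noteq> j \<longrightarrow> C l i \<inter> C l j = {}"
      proof (intro ballI impI equals0I)
        fix i j g assume "i \<noteq> j" and g: "g \<in> C l i \<inter> C l j"
        then obtain f f' where "f \<in> A l" "out f g = i" "f' \<in> A l" "out f' g = j" "g \<in> B l"
          unfolding C_def by auto
        with out_unique[of f l f' g] \<open>i \<noteq> j\<close> show False by simp
      qed
    qed (simp_all add: fin finC)
    also have "\<dots> \<le> card (B l)" using CB finB by (intro card_mono) auto
    finally show ?thesis .
  qed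

  \<comment> \<open>Each pair of functions lies in exactly one rectangle, and separate conditions on
    \<open>f\<close> and on \<open>g\<close> keep it a rectangle. The four totals that
    \<open>cut_and_paste\<close> asks for are instances.\<close>
  have part: "(\<Sum>l\<in>L. real (card {f \<in> A l. X f}) * card {g \<in> B l. Y g})
      = real (card {f \<in> F. X f}) * card {g \<in> F. Y g}" for X Y
  proof -
    let ?Z = "{f \<in> F. X f} \<times> {g \<in> F. Y g}"
    have img: "(\<lambda>z. T (fst z) (snd z)) ` ?Z \<subseteq> L" using TL by auto
    have "card ?Z = (\<Sum>l\<in>L. card {z \<in> ?Z. T (fst z) (snd z) = l})"
      using sum.group[OF _ _ img, of "\<lambda>_. 1::nat"] fin finF by simp
    moreover have "{z \<in> ?Z. T (fst z) (snd z) = l} = {f \<in> A l. X f} \<times> {g \<in> B l. Y g}" for l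
    proof (intro Set.set_eqI iffI)
      fix z assume "z \<in> {f \<in> A l. X f} \<times> {g \<in> B l. Y g}"
      then show "z \<in> {z \<in> ?Z. T (fst z) (snd z) = l}"
        using subsetD[OF AF[of l], of "fst z"] subsetD[OF BF[of l], of "snd z"] Tiff[of "fst z" "snd z" l]
        by auto
    next
      fix z assume "z \<in> {z \<in> ?Z. T (fst z) (snd z) = l}"
      then show "z \<in> {f \<in> A l. X f} \<times> {g \<in> B l. Y g}"
        using Tiff[of "fst z" "snd z" l] by auto
    qed
    ultimately have "(\<Sum>l\<in>L. card {f \<in> A l. X f} * card {g \<in> B l. Y g}) = card {f \<in> F. X f} * card {g \<in> F. Y g}"
      by (simp add: card_cartesian_product)
    then show ?thesis by (metis (mono_tags, lifting) of_nat_mult of_nat_sum sum.cong)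
  qed
  have cF: "N * card {f \<in> F. f i = u} = m" if "i \<in> I" "u \<in> S" for i u
  proof -
    have "card {f \<in> F. f i = u} * card S = card F"
      using card_PiE_fixed[of I "{i}" u S] fin that by (simp add: F_def)
    then show ?thesis unfolding N_def m_def by (metis mult.commute of_nat_mult)
  qed

  \<comment> \<open>probabilities of the rectangle sides conditioned on the value at \<open>i\<close>: \<open>m / N\<close> functions take a given value there\<close>
  define a where "a l i u = N * card {f \<in> A l. f i = u} / m" for l i u
  define b where "b l i u = N * card {f \<in> B l. f i = u} / m" for l i u
  define c where "c l i u = N * card {f \<in> C l i. f i = u} / m" for l i u
  define \<alpha> where "\<alpha> l = card (A l) / m" for l
  define \<beta> where "\<beta> l = card (B l) / m" for l
  note defs = a_def b_def c_def \<alpha>_def \<beta>_def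
  have nn: "a l i u \<ge> 0" "b l i u \<ge> 0" "c l i u \<ge> 0" "\<alpha> l \<ge> 0" "\<beta> l \<ge> 0" for l i u
    using N m by (auto simp: defs)
  have cb: "c l i u \<le> b l i u" for l i u
    using N m CB[of l i] finB
    by (auto simp: defs intro!: divide_right_mono mult_left_mono card_mono)
  have le1: "\<alpha> l \<le> 1" "\<beta> l \<le> 1" for l
    using AF[of l] BF[of l] finF m by (auto simp: defs m_def card_mono)
  have s\<alpha>\<beta>: "(\<Sum>l\<in>L. \<alpha> l * \<beta> l) = 1"
  proof -
    have "(\<Sum>l\<in>L. \<alpha> l * \<beta> l) = (\<Sum>l\<in>L. real (card (A l)) * card (B l)) / (m * m)"
      by (simp add: defs sum_divide_distrib)
    also have "\<dots> = 1" using part[of "\<lambda>_. True" "\<lambda>_. True"] m by (simp flip: m_def)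
    finally show ?thesis .
  qed
  have s\<alpha>b: "(\<Sum>l\<in>L. \<alpha> l * b l i v) = 1" if "i \<in> I" "v \<in> S" for i v
  proof -
    have "(\<Sum>l\<in>L. \<alpha> l * b l i v) = N * (\<Sum>l\<in>L. real (card (A l)) * card {g \<in> B l. g i = v}) / (m * m)"
      by (simp add: defs sum_divide_distrib sum_distrib_left mult_ac)
    also have "\<dots> = m * (N * card {g \<in> F. g i = v}) / (m * m)"
      using part[of "\<lambda>_. True" "\<lambda>g. g i = v"] by (simp flip: m_def)
    finally show ?thesis using cF[OF that] m by simp
  qed
  have sa\<beta>: "(\<Sum>l\<in>L. a l i u * \<beta> l) = 1" if "i \<in> I" "u \<in> S" for i u
  proof -
    have "(\<Sum>l\<in>L. a l i u * \<beta> l) = N * (\<Sum>l\<in>L. real (card {f \<in> A l. f i = u}) * card (B l)) / (m * m)"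
      by (simp add: defs sum_divide_distrib sum_distrib_left mult_ac)
    also have "\<dots> = (N * card {f \<in> F. f i = u}) * m / (m * m)"
      using part[of "\<lambda>g. g i = u" "\<lambda>_. True"] by (simp flip: m_def)
    finally show ?thesis using cF[OF that] m by simp
  qed
  have sab: "(\<Sum>l\<in>L. a l i u * b l i v) = 1" if "i \<in> I" "u \<in> S" "v \<in> S" for i u v
  proof -
    have "(\<Sum>l\<in>L. a l i u * b l i v)
      = N * N * (\<Sum>l\<in>L. real (card {f \<in> A l. f i = u}) * card {g \<in> B l. g i = v}) / (m * m)"
      by (simp add: defs sum_divide_distrib sum_distrib_left mult_ac)
    also have "\<dots> = (N * card {f \<in> F. f i = u}) * (N * card {g \<in> F. g i = v}) / (m * m)"
      using part[of "\<lambda>g. g i = u" "\<lambda>g. g i = v"] by simp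
    finally show ?thesis using cF[of i u] cF[of i v] that m by simp
  qed

  let ?W = "\<lambda>i. {z \<in> F \<times> F. snd z i = \<tau> (fst z i) \<and> out (fst z) (snd z) = i}"
  \<comment> \<open>The pairs are grouped by \<open>u = f i\<close> and the transcript
    \<open>l\<close>. Each group lies in a product set, since \<open>u\<close> determines
    \<open>g i\<close> as \<open>\<tau> u\<close>.\<close>
  have count: "N * N / (m * m) * card (?W i) \<le> (\<Sum>u\<in>S. \<Sum>l\<in>L. a l i u * c l i (\<tau> u))"
    if i: "i \<in> I" for i
  proof -
    have "(\<lambda>z. (fst z i, T (fst z) (snd z))) ` ?W i \<subseteq> S \<times> L"
      using i TL by (auto simp: F_def PiE_iff)
    from sum.group[OF _ _ this, of "\<lambda>_. 1::nat"]
    have "card (?W i) = (\<Sum>x\<in>S \<times> L. card {z \<in> ?W i. (fst z i, T (fst z) (snd z)) = x})"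
      using fin finF by simp
    also have "\<dots> = (\<Sum>u\<in>S. \<Sum>l\<in>L. card {z \<in> ?W i. (fst z i, T (fst z) (snd z)) = (u, l)})"
      by (simp only: sum.cartesian_product case_prod_unfold prod.collapse)
    also have "\<dots> \<le> (\<Sum>u\<in>S. \<Sum>l\<in>L. card ({f \<in> A l. f i = u} \<times> {g \<in> C l i. g i = \<tau> u}))"
    proof (intro sum_mono card_mono)
      fix u l
      show "{z \<in> ?W i. (fst z i, T (fst z) (snd z)) = (u, l)} \<subseteq> {f \<in> A l. f i = u} \<times> {g \<in> C l i. g i = \<tau> u}"
      proof
        fix z assume z: "z \<in> {z \<in> ?W i. (fst z i, T (fst z) (snd z)) = (u, l)}"
        then show "z \<in> {f \<in> A l. f i = u} \<times> {g \<in> C l i. g i = \<tau> u}"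
          using Tiff[of "fst z" "snd z" l] by (auto simp: C_def)
      qed
    qed (use finA finC in simp)
    finally have "real (card (?W i))
        \<le> (\<Sum>u\<in>S. \<Sum>l\<in>L. real (card {f \<in> A l. f i = u}) * card {g \<in> C l i. g i = \<tau> u})"
      by (simp add: card_cartesian_product flip: of_nat_mult of_nat_sum)
    then have "N * N / (m * m) * card (?W i)
        \<le> N * N / (m * m) * (\<Sum>u\<in>S. \<Sum>l\<in>L. real (card {f \<in> A l. f i = u}) * card {g \<in> C l i. g i = \<tau> u})"
      using N m by (intro mult_left_mono) auto
    also have "\<dots> = (\<Sum>u\<in>S. \<Sum>l\<in>L. a l i u * c l i (\<tau> u))"
      by (simp add: defs sum_distrib_left mult_ac)
    finally show ?thesis .
  qed
  \<comment> \<open>Exchanges the conditioned probability \<open>a l i u\<close> for the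
    unconditioned \<open>\<alpha> l\<close>. In the error term the output no longer matters, so
    \<open>c\<close> is enlarged to \<open>b\<close>.\<close>
  have split: "a l i u * c l i v \<le> 2 * (\<alpha> l * c l i v) + 2 * (b l i v * (sqrt (a l i u) - sqrt (\<alpha> l))\<^sup>2)"
    for l i u v
  proof -
    let ?d = "sqrt (a l i u) - sqrt (\<alpha> l)"
    have "x\<^sup>2 \<le> 2 * y\<^sup>2 + 2 * (x - y)\<^sup>2" for x y :: real
      using zero_le_power2[of "x - 2 * y"] by (simp add: power2_eq_square algebra_simps)
    from this[of "sqrt (a l i u)" "sqrt (\<alpha> l)"] have "a l i u \<le> 2 * \<alpha> l + 2 * ?d\<^sup>2" using nn by simp
    then have "a l i u * c l i v \<le> (2 * \<alpha> l + 2 * ?d\<^sup>2) * c l i v"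
      using nn by (intro mult_right_mono)
    also have "\<dots> \<le> 2 * (\<alpha> l * c l i v) + 2 * (b l i v * ?d\<^sup>2)"
      using mult_right_mono[OF cb[of l i v], of "?d\<^sup>2"] by (simp add: algebra_simps)
    finally show ?thesis .
  qed
  have reindex: "(\<Sum>u\<in>S. h (\<tau> u)) = (\<Sum>v\<in>S. h v)" for h :: "'s \<Rightarrow> real"
    using \<tau> by (rule sum.reindex_bij_betw)
  have \<tau>S: "\<tau> u \<in> S" if "u \<in> S" for u using \<tau> that by (auto simp: bij_betw_def)

  \<comment> \<open>The main term: with \<open>f\<close> unconditioned, the sum over
    \<open>u\<close> runs through all values of \<open>g i\<close> and so recovers the whole of
    \<open>C l i\<close>. Disjointness of these sets then leaves a total mass of at most 1, times
    \<open>N\<close>.\<close>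
  have first: "(\<Sum>i\<in>I. \<Sum>u\<in>S. \<Sum>l\<in>L. \<alpha> l * c l i (\<tau> u)) \<le> N"
  proof -
    have "(\<Sum>u\<in>S. c l i (\<tau> u)) = N * card (C l i) / m" if "i \<in> I" for i l
    proof -
      have "(\<lambda>f. f i) ` C l i \<subseteq> S" using that CB BF by (fastforce simp: F_def PiE_iff)
      from sum_card_fibre[OF finC fin(2) this, of "\<lambda>_. 1"]
      have "(\<Sum>u\<in>S. real (card {f \<in> C l i. f i = u})) = card (C l i)" by simp
      then show ?thesis
        using reindex[of "\<lambda>v. c l i v"] by (simp add: c_def flip: sum_divide_distrib sum_distrib_left)
    qed
    then have *: "(\<Sum>i\<in>I. \<Sum>u\<in>S. c l i (\<tau> u)) = N / m * (\<Sum>i\<in>I. real (card (C l i)))" for l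
      by (simp add: sum_distrib_left)
    have "(\<Sum>i\<in>I. \<Sum>u\<in>S. \<Sum>l\<in>L. \<alpha> l * c l i (\<tau> u)) = (\<Sum>i\<in>I. \<Sum>l\<in>L. \<Sum>u\<in>S. \<alpha> l * c l i (\<tau> u))"
      by (intro sum.cong refl sum.swap)
    also have "\<dots> = (\<Sum>l\<in>L. \<Sum>i\<in>I. \<Sum>u\<in>S. \<alpha> l * c l i (\<tau> u))" by (rule sum.swap)
    also have "\<dots> = (\<Sum>l\<in>L. \<alpha> l * (N / m * (\<Sum>i\<in>I. real (card (C l i)))))"
      by (simp only: * flip: sum_distrib_left)
    also have "\<dots> \<le> (\<Sum>l\<in>L. \<alpha> l * (N / m * card (B l)))"
      using nn N m sumC by (intro sum_mono mult_left_mono) (auto simp flip: of_nat_sum)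
    also have "\<dots> = N * (\<Sum>l\<in>L. \<alpha> l * \<beta> l)" by (simp add: \<beta>_def sum_distrib_left mult_ac)
    finally show ?thesis using s\<alpha>\<beta> by simp
  qed

  have hA: "(\<Sum>i\<in>I. \<Sum>u\<in>S. (sqrt (a l i u) - sqrt (\<alpha> l))\<^sup>2) \<le> N * \<alpha> l * ln (1 / \<alpha> l)" for l
    using sum_hellinger_fixed_coordinate_le[OF fin(1,2) AF[of l, unfolded F_def]]
    by (simp add: defs N_def m_def flip: F_def)
  have hB: "(\<Sum>i\<in>I. \<Sum>v\<in>S. (sqrt (b l i v) - sqrt (\<beta> l))\<^sup>2) \<le> N * \<beta> l * ln (1 / \<beta> l)" for l
    using sum_hellinger_fixed_coordinate_le[OF fin(1,2) BF[of l, unfolded F_def]]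
    by (simp add: defs N_def m_def flip: F_def)
  have swap: "(\<Sum>i\<in>I. \<Sum>u\<in>S. \<Sum>l\<in>L. w l * h l i u) = (\<Sum>l\<in>L. w l * (\<Sum>i\<in>I. \<Sum>u\<in>S. h l i u))"
    for w :: "'l \<Rightarrow> real" and h :: "'l \<Rightarrow> 'i \<Rightarrow> 's \<Rightarrow> real"
  proof -
    have "(\<Sum>i\<in>I. \<Sum>u\<in>S. \<Sum>l\<in>L. w l * h l i u) = (\<Sum>i\<in>I. \<Sum>l\<in>L. \<Sum>u\<in>S. w l * h l i u)"
      by (intro sum.cong refl sum.swap)
    also have "\<dots> = (\<Sum>l\<in>L. \<Sum>i\<in>I. \<Sum>u\<in>S. w l * h l i u)" by (rule sum.swap)
    finally show ?thesis by (simp add: sum_distrib_left)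
  qed
  \<comment> \<open>The error term: \<open>cut_and_paste\<close> reduces fixing both values at
    \<open>i\<close> to fixing one at a time. There \<open>hA\<close> and \<open>hB\<close> apply,
    and what remains is the entropy of the transcript distribution
    \<open>\<alpha> l * \<beta> l\<close>.\<close>
  have second: "(\<Sum>i\<in>I. \<Sum>u\<in>S. \<Sum>l\<in>L. b l i (\<tau> u) * (sqrt (a l i u) - sqrt (\<alpha> l))\<^sup>2) \<le> 6 * N * ln (card L)"
  proof -
    have "(\<Sum>i\<in>I. \<Sum>u\<in>S. \<Sum>l\<in>L. b l i (\<tau> u) * (sqrt (a l i u) - sqrt (\<alpha> l))\<^sup>2)
      \<le> (\<Sum>i\<in>I. \<Sum>u\<in>S. 4 * (\<Sum>l\<in>L. \<beta> l * (sqrt (a l i u) - sqrt (\<alpha> l))\<^sup>2)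
           + 6 * (\<Sum>l\<in>L. \<alpha> l * (sqrt (b l i (\<tau> u)) - sqrt (\<beta> l))\<^sup>2))"
      by (intro sum_mono cut_and_paste nn sab sa\<beta> s\<alpha>b s\<alpha>\<beta> \<tau>S)
    also have "\<dots> = 4 * (\<Sum>i\<in>I. \<Sum>u\<in>S. \<Sum>l\<in>L. \<beta> l * (sqrt (a l i u) - sqrt (\<alpha> l))\<^sup>2)
        + 6 * (\<Sum>i\<in>I. \<Sum>u\<in>S. \<Sum>l\<in>L. \<alpha> l * (sqrt (b l i u) - sqrt (\<beta> l))\<^sup>2)"
      using reindex[of "\<lambda>v. \<Sum>l\<in>L. \<alpha> l * (sqrt (b l i v) - sqrt (\<beta> l))\<^sup>2" for i]
      by (simp add: sum.distrib flip: sum_distrib_left)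
    also have "\<dots> = (\<Sum>l\<in>L. 4 * (\<beta> l * (\<Sum>i\<in>I. \<Sum>u\<in>S. (sqrt (a l i u) - sqrt (\<alpha> l))\<^sup>2))
        + 6 * (\<alpha> l * (\<Sum>i\<in>I. \<Sum>u\<in>S. (sqrt (b l i u) - sqrt (\<beta> l))\<^sup>2)))"
      by (simp only: swap sum.distrib sum_distrib_left)
    also have "\<dots> \<le> (\<Sum>l\<in>L. 4 * (\<beta> l * (N * \<alpha> l * ln (1 / \<alpha> l))) + 6 * (\<alpha> l * (N * \<beta> l * ln (1 / \<beta> l))))"
      using hA hB nn by (intro sum_mono add_mono mult_left_mono) auto
    \<comment> \<open>Raising 4 to 6 lets the two logarithms merge into one; it is allowed because
      \<open>\<alpha> l \<le> 1\<close> makes \<open>ln (1 / \<alpha> l)\<close>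
      nonnegative.\<close>
    also have "\<dots> \<le> (\<Sum>l\<in>L. 6 * N * (\<alpha> l * \<beta> l * ln (1 / (\<alpha> l * \<beta> l))))"
    proof (rule sum_mono)
      fix l assume "l \<in> L"
      show "4 * (\<beta> l * (N * \<alpha> l * ln (1 / \<alpha> l))) + 6 * (\<alpha> l * (N * \<beta> l * ln (1 / \<beta> l)))
        \<le> 6 * N * (\<alpha> l * \<beta> l * ln (1 / (\<alpha> l * \<beta> l)))"
      proof (cases "\<alpha> l = 0 \<or> \<beta> l = 0")
        case False
        then have pos: "\<alpha> l > 0" "\<beta> l > 0" using nn[of l] by (auto simp: less_le)
        have "N * \<alpha> l * \<beta> l * ln (1 / \<alpha> l) \<ge> 0"
          using N pos le1[of l] by (intro mult_nonneg_nonneg) auto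
        moreover have "ln (1 / (\<alpha> l * \<beta> l)) = ln (1 / \<alpha> l) + ln (1 / \<beta> l)"
          using pos by (simp add: ln_div ln_mult_pos)
        ultimately show ?thesis by (simp add: algebra_simps)
      qed auto
    qed
    also have "\<dots> = 6 * N * (\<Sum>l\<in>L. \<alpha> l * \<beta> l * ln (1 / (\<alpha> l * \<beta> l)))"
      by (simp add: sum_distrib_left)
    also have "\<dots> \<le> 6 * N * ln (card L)"
      using N nn by (intro mult_left_mono entropy_le_ln_card fin Lne s\<alpha>\<beta>) auto
    finally show ?thesis .
  qed

  have "N * N / (m * m) * (\<Sum>i\<in>I. card (?W i)) = (\<Sum>i\<in>I. N * N / (m * m) * card (?W i))"
    by (simp add: sum_distrib_left)
  also have "\<dots> \<le> (\<Sum>i\<in>I. \<Sum>u\<in>S. \<Sum>l\<in>L. a l i u * c l i (\<tau> u))"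
    by (intro sum_mono count)
  also have "\<dots> \<le> (\<Sum>i\<in>I. \<Sum>u\<in>S. \<Sum>l\<in>L. 2 * (\<alpha> l * c l i (\<tau> u))
      + 2 * (b l i (\<tau> u) * (sqrt (a l i u) - sqrt (\<alpha> l))\<^sup>2))"
    by (intro sum_mono split)
  also have "\<dots> \<le> 2 * N + 2 * (6 * N * ln (card L))"
    using first second by (simp add: sum.distrib flip: sum_distrib_left)
  finally have "N * (N * (\<Sum>i\<in>I. card (?W i))) \<le> N * (m\<^sup>2 * (2 + 12 * ln (card L)))"
    using m by (simp add: field_simps power2_eq_square)
  then show ?thesis using N by (simp add: N_def m_def)
qed

section \<open>Transcripts of protocols and runs of oracle algorithms\<close>

primrec transcript :: "('a, 'b, 'o) protocol \<Rightarrow> 'a \<Rightarrow> 'b \<Rightarrow> bool list" where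
  "transcript (Output2 g) u v = []"
| "transcript (Send1 m next) u v = m u # transcript (next (m u)) u v"
| "transcript (Send2 m next) u v = m v # transcript (next (m v)) u v"

lemma length_transcript: "length (transcript P u v) = bits P u v"
  by (induction P) auto

text \<open>Each bit depends on its sender's data alone, so the run on \<open>u\<close> and
  \<open>v'\<close> stays on the common path: at \<open>Send1\<close> nodes it sends the bit of
  \<open>u\<close>, at \<open>Send2\<close> nodes that of \<open>v'\<close>. The leaf reached and
  \<open>v'\<close> then determine the output.\<close>

lemma transcript_rectangle:
  assumes "transcript P u v = transcript P u' v'"
  shows "transcript P u v' = transcript P u' v' \<and> output2 P u v' = output2 P u' v'"
  using assms
proof (induction P)
  case (Send2 m next1)
  then show ?case by (cases "m v'") auto
qed auto

lemma queries_cong: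
  assumes "\<And>x. x \<in> set (queries f D) \<Longrightarrow> g x = f x"
  shows "queries g D = queries f D \<and> run_oracle g D = run_oracle f D"
  using assms by (induction D) auto

text \<open>A single power, unlike the exact geometric sum, has a logarithm linear in
  \<open>k\<close>.\<close>

lemma card_bounded_lists_le:
  assumes "finite A"
  shows "card {xs. set xs \<subseteq> A \<and> length xs \<le> k} \<le> (card A + 1) ^ k"
proof -
  have "(\<Sum>i\<le>k. a ^ i) \<le> (a + 1) ^ k" for a :: nat
  proof (induction k)
    case (Suc k)
    have "(\<Sum>i\<le>k. a ^ i) + a * a ^ k \<le> (a + 1) ^ k + a * (a + 1) ^ k"
      by (intro add_mono Suc.IH mult_left_mono power_mono) auto
    then show ?case by simp
  qed simp
  then show ?thesis using assms by (simp add: card_lists_length_le)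
qed

section \<open>Coordinate-wise sums of functions\<close>

lemma finite_funs: "finite (funs n)"
  by (simp add: funs_def finite_PiE)

lemma card_funs: "card (funs n) = n ^ n"
  by (simp add: funs_def card_funcsetE)

lemma funs_memD: "f \<in> funs n \<Longrightarrow> x \<in> {1..n} \<Longrightarrow> f x \<in> {1..n}"
  by (auto simp: funs_def PiE_iff)

lemma fun_sum_in_funs:
  assumes "comm_group K" "carrier K = {1..n}" "f \<in> funs n" "g \<in> funs n"
  shows "fun_sum K n f g \<in> funs n"
proof -
  interpret comm_group K by fact
  have "f x \<otimes>\<^bsub>K\<^esub> g x \<in> {1..n}" if "x \<in> {1..n}" for x
    using m_closed[of "f x" "g x"] funs_memD[OF _ that] assms by auto
  then show ?thesis by (auto simp: fun_sum_def funs_def)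
qed

lemma bij_betw_fun_sum:
  assumes "comm_group K" "carrier K = {1..n}" "g \<in> funs n"
  shows "bij_betw (\<lambda>f. fun_sum K n f g) (funs n) (funs n)"
proof -
  interpret comm_group K by fact
  let ?T = "\<lambda>f. fun_sum K n f g"
  have "inj_on ?T (funs n)"
  proof (rule inj_onI)
    fix f h assume fh: "f \<in> funs n" "h \<in> funs n" and eq: "?T f = ?T h"
    show "f = h"
    proof (rule PiE_ext)
      fix x assume x: "x \<in> {1..n}"
      have "f x \<otimes>\<^bsub>K\<^esub> g x = h x \<otimes>\<^bsub>K\<^esub> g x"
        using fun_cong[OF eq, of x] x by (simp add: fun_sum_def)
      then show "f x = h x"
        using right_cancel[of "g x" "f x" "h x"] funs_memD[OF _ x] fh assms by simp
    qed (use fh in \<open>simp_all add: funs_def\<close>)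
  qed
  moreover have "?T ` funs n \<subseteq> funs n" using fun_sum_in_funs assms by blast
  ultimately show ?thesis using endo_inj_surj[OF finite_funs] by (auto simp: bij_betw_def)
qed

text \<open>The sum of two independent uniform functions is uniform, because adding a fixed
  \<open>g\<close> permutes \<open>funs n\<close>.\<close>

lemma sum_fun_sum:
  fixes h :: "(nat \<Rightarrow> nat) \<Rightarrow> real"
  assumes "comm_group K" "carrier K = {1..n}"
  shows "(\<Sum>(f, g)\<in>funs n \<times> funs n. h (fun_sum K n f g)) = card (funs n) * (\<Sum>f\<in>funs n. h f)"
proof -
  have "(\<Sum>(f, g)\<in>funs n \<times> funs n. h (fun_sum K n f g))
    = (\<Sum>g\<in>funs n. \<Sum>f\<in>funs n. h (fun_sum K n f g))"
    by (subst sum.cartesian_product[symmetric]) (rule sum.swap)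
  also have "\<dots> = (\<Sum>g\<in>funs n. \<Sum>f\<in>funs n. h f)"
    by (intro sum.cong refl sum.reindex_bij_betw bij_betw_fun_sum assms)
  finally show ?thesis by simp
qed

lemma card_eq_sum_of_bool: "finite A \<Longrightarrow> real (card {x \<in> A. P x}) = (\<Sum>x\<in>A. of_bool (P x))"
  by (simp add: Int_def)

lemma funs_image: "f \<in> funs n \<Longrightarrow> f ` {1..n} \<subseteq> {1..n}"
  by (auto simp: funs_def)

section \<open>Collisions and the number of inverted targets\<close>

text \<open>A point other than \<open>x\<close> collides with it with probability at most
  \<open>1 / n\<close>, so all of these together contribute at most \<open>card (funs n)\<close>, as
  much as \<open>x' = x\<close> does alone.\<close>

lemma card_collision_le:
  assumes "x \<in> {1..n}"
  shows "(\<Sum>x'\<in>{1..n}. card {f \<in> funs n. f x = f x'}) \<le> 2 * card (funs n)"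
proof -
  let ?F = "funs n"
  have n: "n > 0" using assms by simp
  have le: "n * card {f \<in> ?F. f x = f x'} \<le> card ?F" if x': "x' \<in> {1..n} - {x}" for x'
  proof -
    have img: "(\<lambda>f. f x) ` {f \<in> ?F. f x = f x'} \<subseteq> {1..n}"
      using funs_memD[OF _ assms] by blast
    have "card {f \<in> ?F. f x = f x'} = (\<Sum>u\<in>{1..n}. card {f \<in> {f \<in> ?F. f x = f x'}. f x = u})"
      using sum.group[OF _ _ img, of "\<lambda>_. 1::nat"] by (simp add: finite_funs)
    also have "\<dots> = (\<Sum>u\<in>{1..n}. card {f \<in> {1..n} \<rightarrow>\<^sub>E {1..n}. \<forall>j\<in>{x, x'}. f j = u})"
      by (intro sum.cong arg_cong[where f = card]) (auto simp: funs_def)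
    finally have "n * card {f \<in> ?F. f x = f x'} * n
      = (\<Sum>u\<in>{1..n}. card {f \<in> {1..n} \<rightarrow>\<^sub>E {1..n}. \<forall>j\<in>{x, x'}. f j = u} * card {1..n} ^ card {x, x'})"
      using x' by (simp add: sum_distrib_left sum_distrib_right power2_eq_square mult_ac)
    also have "\<dots> = (\<Sum>u\<in>{1..n}. card ?F)"
      unfolding funs_def by (intro sum.cong refl card_PiE_fixed) (use assms x' in auto)
    finally show ?thesis using n by (simp add: mult.commute)
  qed
  have "n * (\<Sum>x'\<in>{1..n} - {x}. card {f \<in> ?F. f x = f x'}) \<le> (\<Sum>x'\<in>{1..n} - {x}. card ?F)"
    unfolding sum_distrib_left by (intro sum_mono le)
  also have "\<dots> \<le> n * card ?F" using assms by simp
  finally have "(\<Sum>x'\<in>{1..n} - {x}. card {f \<in> ?F. f x = f x'}) \<le> card ?F" using n by simp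
  then show ?thesis using assms by (subst sum.remove[of _ x]) auto
qed

text \<open>The success probability weights a target by the size of its preimage, whereas the
  protocol bound counts targets. Cauchy-Schwarz removes the weights at the cost of squaring
  \<open>\<alpha>\<close>.\<close>

lemma card_inverted_points_ge:
  assumes "n \<ge> 1" "0 \<le> \<alpha>" "inversion_prob n Pre Dec \<ge> \<alpha>"
  shows "\<alpha>\<^sup>2 * n * card (funs n) \<le> 2 * card {(f, y) \<in> funs n \<times> {1..n}. Inv Pre Dec y f \<in> preimage n f y}"
proof -
  let ?F = "funs n" and ?S = "{1..n}"
  define H where "H f y \<longleftrightarrow> Inv Pre Dec y f \<in> preimage n f y" for f y
  have "card ?F > 0" using assms by (simp add: card_funs)
  then have Fne: "?F \<noteq> {}" by auto
  have "pair_pmf (pmf_of_set ?F) (pmf_of_set ?S) = pmf_of_set (?F \<times> ?S)"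
    by (rule pmf_eqI) (use assms Fne in \<open>auto simp: pmf_pair pmf_of_set[OF Fne finite_funs] finite_funs indicator_def split: prod.splits\<close>)
  then have "inversion_prob n Pre Dec = card ((?F \<times> ?S) \<inter> {(f, x). H f (f x)}) / card (?F \<times> ?S)"
    using assms Fne
    by (simp add: inversion_prob_def H_def finite_funs measure_pmf_of_set del: card_cartesian_product)
  then have "\<alpha> * (card ?F * n) \<le> card ((?F \<times> ?S) \<inter> {(f, x). H f (f x)})"
    using assms \<open>card ?F > 0\<close> pos_le_divide_eq[of "real (card ?F * n)" \<alpha>]
    by (simp add: card_cartesian_product)
  also have "(?F \<times> ?S) \<inter> {(f, x). H f (f x)} = (SIGMA f:?F. {x \<in> ?S. H f (f x)})" by auto
  also have "real (card \<dots>) = (\<Sum>f\<in>?F. \<Sum>x\<in>?S. of_bool (H f (f x)))"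
    by (subst card_SigmaI)
      (simp_all only: of_nat_sum card_eq_sum_of_bool[OF finite_atLeastAtMost] finite_funs, simp)
  also have "\<dots> = (\<Sum>f\<in>?F. \<Sum>y\<in>?S. real (card {x \<in> ?S. f x = y}) * of_bool (H f y))"
    by (rule sum.cong[OF refl], rule sum_card_fibre[symmetric]) (simp_all add: finite_funs funs_image del: One_nat_def)
  also have "\<dots> = (\<Sum>(f, y)\<in>?F \<times> ?S. real (card {x \<in> ?S. f x = y}) * of_bool (H f y))"
    by (rule sum.cartesian_product)
  finally have 1: "\<alpha> * (card ?F * n) \<le> (\<Sum>(f, y)\<in>?F \<times> ?S. real (card {x \<in> ?S. f x = y}) * of_bool (H f y))" .

  \<comment> \<open>The squared preimage sizes of \<open>f\<close> add up to the number of pairs of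
    points on which \<open>f\<close> collides, so \<open>card_collision_le\<close> bounds their
    total.\<close>
  have "(\<Sum>(f, y)\<in>?F \<times> ?S. (real (card {x \<in> ?S. f x = y}))\<^sup>2)
    = (\<Sum>f\<in>?F. \<Sum>y\<in>?S. real (card {x \<in> ?S. f x = y}) * real (card {x \<in> ?S. f x = y}))"
    by (simp add: sum.cartesian_product power2_eq_square)
  also have "\<dots> = (\<Sum>f\<in>?F. \<Sum>x\<in>?S. real (card {x' \<in> ?S. f x' = f x}))"
    by (rule sum.cong[OF refl], rule sum_card_fibre) (simp_all add: finite_funs funs_image del: One_nat_def)
  also have "\<dots> = (\<Sum>x\<in>?S. \<Sum>f\<in>?F. real (card {x' \<in> ?S. f x' = f x}))" by (rule sum.swap)
  also have "\<dots> = (\<Sum>x\<in>?S. \<Sum>f\<in>?F. \<Sum>x'\<in>?S. of_bool (f x = f x'))"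
    by (simp only: eq_commute[of "f x" "f x'" for f x x'] card_eq_sum_of_bool[OF finite_atLeastAtMost])
  also have "\<dots> = (\<Sum>x\<in>?S. \<Sum>x'\<in>?S. \<Sum>f\<in>?F. of_bool (f x = f x'))"
    by (intro sum.cong refl sum.swap)
  also have "\<dots> = real (\<Sum>x\<in>?S. \<Sum>x'\<in>?S. card {f \<in> ?F. f x = f x'})"
    by (simp only: of_nat_sum card_eq_sum_of_bool[OF finite_funs])
  also have "\<dots> \<le> real (\<Sum>x\<in>?S. 2 * card ?F)"
    by (intro of_nat_mono sum_mono card_collision_le)
  finally have 2: "(\<Sum>(f, y)\<in>?F \<times> ?S. (real (card {x \<in> ?S. f x = y}))\<^sup>2) \<le> 2 * n * card ?F" by simp

  have 3: "(\<Sum>(f, y)\<in>?F \<times> ?S. (of_bool (H f y) :: real)\<^sup>2) = card {(f, y) \<in> ?F \<times> ?S. H f y}"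
  proof -
    have "(\<Sum>(f, y)\<in>?F \<times> ?S. (of_bool (H f y) :: real)\<^sup>2) = (\<Sum>z\<in>?F \<times> ?S. of_bool (case z of (f, y) \<Rightarrow> H f y))"
      by (intro sum.cong) auto
    also have "\<dots> = card {(f, y) \<in> ?F \<times> ?S. H f y}"
      by (subst card_eq_sum_of_bool[symmetric])
        (simp_all add: finite_funs case_prod_unfold mem_Times_iff)
    finally show ?thesis .
  qed
  have "(\<alpha> * (card ?F * n))\<^sup>2 \<le> (\<Sum>(f, y)\<in>?F \<times> ?S. real (card {x \<in> ?S. f x = y}) * of_bool (H f y))\<^sup>2"
    using assms by (intro power_mono 1) auto
  also have "\<dots> \<le> (\<Sum>(f, y)\<in>?F \<times> ?S. (real (card {x \<in> ?S. f x = y}))\<^sup>2) * (\<Sum>(f, y)\<in>?F \<times> ?S. (of_bool (H f y))\<^sup>2)"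
    using Cauchy_Schwarz_ineq_sum[of "\<lambda>(f, y). real (card {x \<in> ?S. f x = y})" "\<lambda>(f, y). of_bool (H f y)" "?F \<times> ?S"]
    by (simp only: case_prod_unfold)
  also have "\<dots> \<le> real (2 * n * card ?F) * real (card {(f, y) \<in> ?F \<times> ?S. H f y})"
    unfolding 3 by (intro mult_right_mono 2) simp
  finally have "(card ?F * n) * (\<alpha>\<^sup>2 * n * card ?F) \<le> (card ?F * n) * (2 * card {(f, y) \<in> ?F \<times> ?S. H f y})"
    by (simp add: power2_eq_square mult_ac)
  then show ?thesis
    using \<open>card ?F > 0\<close> assms by (simp only: mult_le_cancel_left_pos H_def) simp
qed

section \<open>From inversion to communication\<close>

text \<open>The left side is the expected number of \<open>a\<close> for which \<open>E a w\<close>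
  holds. This carries a bound for each fixed outcome of the coins over to a randomized
  protocol.\<close>

lemma sum_prob_le:
  fixes b :: real
  assumes "finite A" "\<And>w. w \<in> set_pmf p \<Longrightarrow> card {a \<in> A. E a w} \<le> b"
  shows "(\<Sum>a\<in>A. measure_pmf.prob p {w. E a w}) \<le> b"
proof -
  have "(\<Sum>a\<in>A. measure_pmf.prob p {w. E a w}) = (\<integral>w. (\<Sum>a\<in>A. indicator {w. E a w} w) \<partial>measure_pmf p)"
    by (subst Bochner_Integration.integral_sum) (auto simp: measure_pmf.emeasure_eq_measure)
  also have "\<dots> \<le> b"
  proof (rule measure_pmf.integral_le_const)
    show "integrable (measure_pmf p) (\<lambda>w. \<Sum>a\<in>A. indicator {w. E a w} w :: real)"
      by (intro Bochner_Integration.integrable_sum) (auto simp: measure_pmf.emeasure_eq_measure)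
    show "AE w in measure_pmf p. (\<Sum>a\<in>A. indicator {w. E a w} w :: real) \<le> b"
      using assms by (simp add: AE_measure_pmf_iff indicator_def of_bool_def[symmetric] Int_def)
  qed
  finally show ?thesis .
qed

text \<open>With the coins fixed, protocol and decoder together form one deterministic protocol, to
  which \<open>sum_card_planted_le\<close> applies.\<close>

lemma card_inverted_through_protocol_le:
  assumes inv: "inversion_algorithm n s q Pre Dec"
    and K: "comm_group K" "carrier K = {1..n}"
    and k: "comm_complexity (funs n) P = k"
    and w: "w \<in> set_pmf (coins P)" and y: "y \<in> {1..n}"
  defines "F \<equiv> funs n"
  shows "n * card {z \<in> F \<times> F. Inv Pre Dec y (fun_sum K n (fst z) (snd z)) \<in> preimage n (fun_sum K n (fst z) (snd z)) y
        \<and> exec_output P (fst z) (snd z) w = Pre (fun_sum K n (fst z) (snd z))}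
    \<le> (real (card F))\<^sup>2 * (2 + 12 * ln (real (3 ^ k * (n\<^sup>2 + 1) ^ q)))"
proof -
  interpret comm_group K by fact
  obtain r r1 r2 where w_eq: "w = (r, r1, r2)" by (cases w)
  define S where "S = {1..n}"
  have FS: "F = S \<rightarrow>\<^sub>E S" by (simp add: F_def S_def funs_def)
  define adv where "adv f g = exec_output P f g w" for f g
  have adv: "adv f g = output2 (tree P) (r, r1, f) (r, r2, g)" for f g
    by (simp add: adv_def w_eq exec_output_def)
  \<comment> \<open>An erroneous protocol output may have the wrong length, where \<open>Dec\<close> is unconstrained.\<close>
  define D where "D a = (if length a = s then Dec y a else Answer 0)" for a
  define bs where "bs f g = transcript (tree P) (r, r1, f) (r, r2, g)" for f g
  define qs where "qs f g = queries (fun_sum K n f g) (D (adv f g))" for f g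
  \<comment> \<open>The second party asks for \<open>f x\<close> and adds \<open>g x\<close> itself.
    Recording the first party's values, and not the oracle's answers, keeps the transcript classes
    rectangular.\<close>
  define T where "T f g = (bs f g, map (\<lambda>x. (x, f x)) (qs f g))" for f g
  define out where "out f g = run_oracle (fun_sum K n f g) (D (adv f g))" for f g
  define L where "L = {b :: bool list. set b \<subseteq> UNIV \<and> length b \<le> k} \<times> {l. set l \<subseteq> S \<times> S \<and> length l \<le> q}"

  have finL: "finite L" unfolding L_def S_def
    by (intro finite_cartesian_product finite_lists_length_le) auto
  \<comment> \<open>The bases are 2 bits plus 1 and \<open>n * n\<close> query-reply pairs plus 1;
    the extra 1 accounts for shorter lists.\<close>
  have cardL: "card L \<le> 3 ^ k * (n\<^sup>2 + 1) ^ q"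
    using mult_mono[OF card_bounded_lists_le[of "UNIV :: bool set" k] card_bounded_lists_le[of "S \<times> S" q]]
    by (simp add: L_def S_def card_cartesian_product power2_eq_square)

  have TL: "T f g \<in> L" if "f \<in> F" "g \<in> F" for f g
  proof -
    have "exec_bits P f g w \<le> Max {exec_bits P f g w |f g w. f \<in> F \<and> g \<in> F \<and> w \<in> set_pmf (coins P)}"
      using that w by (intro Max_ge finite_exec_bits) blast
    then have "length (bs f g) \<le> k"
      using k by (simp add: comm_complexity_def F_def bs_def length_transcript exec_bits_def w_eq)
    moreover have "set (qs f g) \<subseteq> S \<and> length (qs f g) \<le> q"
      using inv y fun_sum_in_funs[OF K] that
      by (auto simp: inversion_algorithm_def qs_def D_def S_def F_def)
    moreover have "f x \<in> S" if "x \<in> S" for x using \<open>f \<in> F\<close> that by (auto simp: FS)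
    ultimately show ?thesis by (auto simp: T_def L_def)
  qed
  have rect: "T f1 g2 = T g1 g2 \<and> out f1 g2 = out g1 g2" if eq: "T f1 f2 = T g1 g2" for f1 f2 g1 g2
  proof -
    have t: "bs f1 g2 = bs g1 g2" "adv f1 g2 = adv g1 g2"
      using eq transcript_rectangle[of "tree P" "(r, r1, f1)" "(r, r2, f2)" "(r, r1, g1)" "(r, r2, g2)"]
      by (auto simp: T_def bs_def adv)
    \<comment> \<open>The query-reply pairs force \<open>f1\<close> and \<open>g1\<close> to agree
      wherever the run on \<open>g1\<close> and \<open>g2\<close> looks, so replacing
      \<open>g1\<close> by \<open>f1\<close> leaves that run unchanged.\<close>
    have "f1 x = g1 x" if "x \<in> set (qs g1 g2)" for x
    proof -
      have "(x, g1 x) \<in> set (map (\<lambda>x. (x, f1 x)) (qs f1 f2))" using eq that by (auto simp: T_def)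
      then show ?thesis by auto
    qed
    then have same: "\<forall>x\<in>set (qs g1 g2). f1 x = g1 x" by blast
    then have "fun_sum K n f1 g2 x = fun_sum K n g1 g2 x" if "x \<in> set (qs g1 g2)" for x
      using that by (simp add: fun_sum_def restrict_def)
    then have "qs f1 g2 = qs g1 g2 \<and> out f1 g2 = out g1 g2"
      using queries_cong[of "fun_sum K n g1 g2" "D (adv g1 g2)" "fun_sum K n f1 g2"]
      by (simp add: qs_def out_def t)
    then show ?thesis using same t by (simp add: T_def)
  qed
  \<comment> \<open>The value that \<open>g i\<close> must have, given \<open>f i = u\<close>, for
    the sum to be \<open>y\<close> at \<open>i\<close>.\<close>
  define \<tau> where "\<tau> u = inv\<^bsub>K\<^esub> u \<otimes>\<^bsub>K\<^esub> y" for u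
  have \<tau>: "bij_betw \<tau> S S"
  proof -
    have "inj_on \<tau> S"
    proof (rule inj_onI)
      fix u v assume uv: "u \<in> S" "v \<in> S" "\<tau> u = \<tau> v"
      then have "u \<in> carrier K" "v \<in> carrier K" "y \<in> carrier K" using y K(2) by (simp_all add: S_def)
      moreover from this have "inv\<^bsub>K\<^esub> u = inv\<^bsub>K\<^esub> v" using uv(3) by (simp add: \<tau>_def)
      ultimately show "u = v" using inv_inv by metis
    qed
    moreover have "\<tau> u \<in> S" if "u \<in> S" for u
      using that y K(2) m_closed[of "inv\<^bsub>K\<^esub> u" y] inv_closed[of u] unfolding \<tau>_def S_def by simp
    then have "\<tau> ` S \<subseteq> S" by blast
    ultimately show ?thesis using endo_inj_surj[of S] by (simp add: bij_betw_def S_def)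
  qed
  have planted: "g i = \<tau> (f i)" if "f \<in> F" "g \<in> F" "i \<in> S" "fun_sum K n f g i = y" for f g i
  proof -
    have "f i \<in> carrier K" "g i \<in> carrier K" using that K(2) by (auto simp: FS S_def PiE_iff)
    then show ?thesis using that(3,4) by (auto simp: \<tau>_def fun_sum_def S_def m_assoc[symmetric] l_inv)
  qed
  let ?W = "\<lambda>i. {z \<in> F \<times> F. snd z i = \<tau> (fst z i) \<and> out (fst z) (snd z) = i}"
  let ?G = "{z \<in> F \<times> F. Inv Pre Dec y (fun_sum K n (fst z) (snd z)) \<in> preimage n (fun_sum K n (fst z) (snd z)) y
        \<and> exec_output P (fst z) (snd z) w = Pre (fun_sum K n (fst z) (snd z))}"
  \<comment> \<open>Correct advice makes \<open>out\<close> the answer of \<open>Inv\<close>, so on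
    success the output is itself a point where \<open>y\<close> is planted.\<close>
  have "?G \<subseteq> (\<Union>i\<in>S. ?W i)"
  proof
    fix z assume z: "z \<in> ?G"
    let ?f = "fun_sum K n (fst z) (snd z)" and ?i = "out (fst z) (snd z)"
    have zF: "fst z \<in> F" "snd z \<in> F" using z by auto
    have "length (Pre ?f) = s"
      using inv fun_sum_in_funs[OF K] zF by (simp add: inversion_algorithm_def F_def)
    then have "?i = Inv Pre Dec y ?f"
      using z by (simp add: out_def D_def adv_def Inv_def)
    then have "?i \<in> preimage n ?f y" using z by simp
    then have "?i \<in> S" "?f ?i = y" by (simp_all add: preimage_def S_def)
    then show "z \<in> (\<Union>i\<in>S. ?W i)" using planted zF z by auto
  qed
  then have "card ?G \<le> card (\<Union>i\<in>S. ?W i)"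
    by (intro card_mono) (auto simp: S_def F_def finite_funs)
  also have "\<dots> \<le> (\<Sum>i\<in>S. card (?W i))" by (rule card_UN_le) (simp add: S_def)
  finally have "real (n * card ?G) \<le> real (card S * (\<Sum>i\<in>S. card (?W i)))"
    by (intro of_nat_mono mult_mono) (simp_all add: S_def)
  also have "\<dots> \<le> (real (card F))\<^sup>2 * (2 + 12 * ln (card L))"
  proof (rule sum_card_planted_le[where I = S and S = S and T = T, folded FS, unfolded of_nat_power])
    show "finite S" "finite S" "finite L" "S \<noteq> {}" using y finL by (auto simp: S_def)
  qed (fact \<tau>, fact TL, rule rect)
  also have "\<dots> \<le> (real (card F))\<^sup>2 * (2 + 12 * ln (real (3 ^ k * (n\<^sup>2 + 1) ^ q)))"
  proof -
    have "F \<noteq> {}" using y by (auto simp: FS S_def PiE_eq_empty_iff)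
    then have "card L > 0" using TL finL by (auto simp: card_gt_0_iff)
    then have "ln (card L) \<le> ln (real (3 ^ k * (n\<^sup>2 + 1) ^ q))" using cardL by (intro ln_mono of_nat_mono) auto
    then show ?thesis by (intro mult_left_mono) auto
  qed
  finally show ?thesis .
qed

text \<open>Consider the targets and input pairs for which \<open>Inv\<close> succeeds on the sum.
  Each survives the protocol with probability at least \<open>1 - \<gamma>\<close>, while for any
  fixed coins only a bounded number survive; the size of the set itself comes from
  \<open>card_inverted_points_ge\<close> and the uniformity of the sum.\<close>

lemma advantage_le:
  assumes n: "n \<ge> 1" and inv: "inversion_algorithm n s q Pre Dec"
    and \<alpha>: "0 \<le> \<alpha>" "inversion_prob n Pre Dec \<ge> \<alpha>"
    and K: "comm_group K" "carrier K = {1..n}"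
    and k: "comm_complexity (funs n) P = k"
    and \<gamma>: "\<gamma> \<le> 1"
    and P: "\<forall>f1\<in>funs n. \<forall>f2\<in>funs n.
      measure_pmf.prob (coins P) {w. exec_output P f1 f2 w = Pre (fun_sum K n f1 f2)} \<ge> 1 - \<gamma>"
  shows "\<alpha>\<^sup>2 * (1 - \<gamma>) * n \<le> 2 * (2 + 12 * ln (real (3 ^ k * (n\<^sup>2 + 1) ^ q)))"
proof -
  define F where "F = funs n"
  define m where "m = real (card F)"
  define B where "B = 2 + 12 * ln (real (3 ^ k * (n\<^sup>2 + 1) ^ q))"
  define good where "good f y \<longleftrightarrow> Inv Pre Dec y f \<in> preimage n f y" for f y
  define sm where "sm z = fun_sum K n (fst z) (snd z)" for z
  have m: "m > 0" using n by (simp add: m_def F_def card_funs)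
  have finF: "finite F" by (simp add: F_def finite_funs)
  let ?A = "SIGMA y:{1..n}. {z \<in> F \<times> F. good (sm z) y}"
  let ?E = "\<lambda>a w. exec_output P (fst (snd a)) (snd (snd a)) w = Pre (sm (snd a))"
  have finA: "finite ?A" using finF by auto
  have le: "card {a \<in> ?A. ?E a w} \<le> m\<^sup>2 * B" if w: "w \<in> set_pmf (coins P)" for w
  proof -
    let ?G = "\<lambda>y. {z \<in> F \<times> F. good (sm z) y \<and> exec_output P (fst z) (snd z) w = Pre (sm z)}"
    have "{a \<in> ?A. ?E a w} = (SIGMA y:{1..n}. ?G y)" by auto
    then have "n * real (card {a \<in> ?A. ?E a w}) = (\<Sum>y\<in>{1..n}. real (n * card (?G y)))"
      using finF by (simp add: card_SigmaI sum_distrib_left)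
    also have "\<dots> \<le> (\<Sum>y\<in>{1..n}. m\<^sup>2 * B)"
    proof (rule sum_mono)
      fix y assume "y \<in> {1..n}"
      from card_inverted_through_protocol_le[OF inv K k w this]
      show "real (n * card (?G y)) \<le> m\<^sup>2 * B"
        by (simp only: good_def sm_def m_def F_def B_def)
    qed
    also have "\<dots> = n * (m\<^sup>2 * B)" by simp
    finally show ?thesis using n by simp
  qed
  have "real (card ?A) * (1 - \<gamma>) = (\<Sum>a\<in>?A. 1 - \<gamma>)" by simp
  also have "\<dots> \<le> (\<Sum>a\<in>?A. measure_pmf.prob (coins P) {w. ?E a w})"
  proof (rule sum_mono)
    fix a assume "a \<in> ?A"
    then have "fst (snd a) \<in> funs n" "snd (snd a) \<in> funs n" by (auto simp: F_def)
    with P show "1 - \<gamma> \<le> measure_pmf.prob (coins P) {w. ?E a w}"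
      by (simp add: sm_def)
  qed
  also have "\<dots> \<le> m\<^sup>2 * B" by (rule sum_prob_le[where E = ?E, OF finA le])
  finally have 1: "real (card ?A) * (1 - \<gamma>) \<le> m\<^sup>2 * B" .

  have "real (card ?A) = (\<Sum>y\<in>{1..n}. real (card {z \<in> F \<times> F. good (sm z) y}))"
    using finF by (subst card_SigmaI) simp_all
  also have "\<dots> = (\<Sum>y\<in>{1..n}. \<Sum>z\<in>F \<times> F. of_bool (good (sm z) y))"
    by (simp only: card_eq_sum_of_bool[OF finite_cartesian_product[OF finF finF]])
  also have "\<dots> = (\<Sum>y\<in>{1..n}. m * (\<Sum>f\<in>F. of_bool (good f y)))"
  proof (rule sum.cong[OF refl])
    fix y
    show "(\<Sum>z\<in>F \<times> F. of_bool (good (sm z) y)) = m * (\<Sum>f\<in>F. of_bool (good f y))"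
      using sum_fun_sum[OF K, of "\<lambda>f. of_bool (good f y)"]
      unfolding sm_def F_def m_def case_prod_unfold .
  qed
  also have "\<dots> = m * (\<Sum>f\<in>F. \<Sum>y\<in>{1..n}. of_bool (good f y))"
    by (simp only: sum_distrib_left[symmetric] sum.swap[of _ F])
  also have "(\<Sum>f\<in>F. \<Sum>y\<in>{1..n}. of_bool (good f y)) = real (card (SIGMA f:F. {y \<in> {1..n}. good f y}))"
    using finF by (subst card_SigmaI) (simp_all only: of_nat_sum card_eq_sum_of_bool[OF finite_atLeastAtMost], simp)
  also have "(SIGMA f:F. {y \<in> {1..n}. good f y}) = {(f, y) \<in> F \<times> {1..n}. good f y}" by auto
  finally have 2: "real (card ?A) = m * card {(f, y) \<in> F \<times> {1..n}. good f y}" .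
  have 3: "\<alpha>\<^sup>2 * n * m \<le> 2 * card {(f, y) \<in> F \<times> {1..n}. good f y}"
    using card_inverted_points_ge[OF n \<alpha>] by (simp add: m_def F_def good_def)
  have "m\<^sup>2 * (\<alpha>\<^sup>2 * (1 - \<gamma>) * n) = m * (\<alpha>\<^sup>2 * n * m) * (1 - \<gamma>)"
    by (simp add: power2_eq_square mult_ac)
  also have "\<dots> \<le> m * (2 * card {(f, y) \<in> F \<times> {1..n}. good f y}) * (1 - \<gamma>)"
    using m \<gamma> 3 by (intro mult_right_mono mult_left_mono) auto
  also have "\<dots> = 2 * (real (card ?A) * (1 - \<gamma>))" by (subst 2) simp
  also have "\<dots> \<le> m\<^sup>2 * (2 * B)" using 1 by simp
  finally have "\<alpha>\<^sup>2 * (1 - \<gamma>) * n \<le> 2 * B"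
    using m by (simp only: mult_le_cancel_left_pos zero_less_power)
  then show ?thesis by (simp only: B_def)
qed

text \<open>The factor 3 serves both parts: \<open>ln 3 \<le> 3\<close> for the bits, and
  \<open>n\<^sup>2 + 1 \<le> n ^ 3\<close> for \<open>n \<ge> 2\<close>, with
  \<open>ln n \<le> log 2 n\<close>, for the queries.\<close>

lemma ln_card_transcripts_le:
  assumes "n \<ge> 2"
  shows "ln (real (3 ^ k * (n\<^sup>2 + 1) ^ q)) \<le> 3 * (k + q * log 2 n)"
proof -
  have "real n ^ 2 + 1 \<le> real n ^ 3"
  proof -
    have "n\<^sup>2 + 1 \<le> n\<^sup>2 * 2" using assms by (simp add: Suc_leI)
    also have "\<dots> \<le> n\<^sup>2 * n" using assms by (intro mult_left_mono) auto
    finally have "n\<^sup>2 + 1 \<le> n ^ 3" by (simp add: power2_eq_square power3_eq_cube)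
    from of_nat_mono[OF this, where 'a = real] show ?thesis
      by (simp only: of_nat_add of_nat_power of_nat_1)
  qed
  then have "ln (real n ^ 2 + 1) \<le> ln (real n ^ 3)" by (intro ln_mono) (auto intro: add_nonneg_pos)
  also have "\<dots> = 3 * ln n" using assms by (simp add: ln_realpow)
  also have "\<dots> \<le> 3 * log 2 n"
    using ln_le_minus_one[of "2 :: real"] assms by (simp add: log_def field_simps)
  finally have l: "ln (real n ^ 2 + 1) \<le> 3 * log 2 n" .
  have "ln (3 :: real) \<le> 3" using ln_le_minus_one[of "3 :: real"] by simp
  then have "real k * ln 3 + real q * ln (real n ^ 2 + 1) \<le> real k * 3 + real q * (3 * log 2 n)"
    using l by (intro add_mono mult_left_mono of_nat_0_le_iff)
  moreover have "ln (real (3 ^ k * (n\<^sup>2 + 1) ^ q)) = real k * ln 3 + real q * ln (real n ^ 2 + 1)"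
    unfolding of_nat_mult of_nat_power of_nat_add of_nat_1 of_nat_numeral
    by (subst ln_mult_pos) (auto simp: ln_realpow add_nonneg_pos intro!: zero_less_power add_nonneg_pos)
  ultimately show ?thesis by (simp add: algebra_simps)
qed

theorem theorem4p11:
  "\<exists>c::real. c > 0 \<and>
     (\<forall>(n::nat) (s::nat) (q::nat) (k::nat) (\<alpha>::real) (\<gamma>::real)
       (Pre :: (nat \<Rightarrow> nat) \<Rightarrow> bool list) (Dec :: nat \<Rightarrow> bool list \<Rightarrow> oracle_alg)
       (K :: nat monoid) (P :: (nat \<Rightarrow> nat, bool list) rand_protocol).
       n \<ge> 1 \<longrightarrow>
       0 < real k + real q * log 2 (real n) \<longrightarrow>
       inversion_algorithm n s q Pre Dec \<longrightarrow>
       0 \<le> \<alpha> \<longrightarrow> inversion_prob n Pre Dec \<ge> \<alpha> \<longrightarrow>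
       comm_group K \<longrightarrow> carrier K = {1..n} \<longrightarrow>
       comm_complexity (funs n) P = k \<longrightarrow>
       0 \<le> \<gamma> \<longrightarrow>
       (\<forall>f1\<in>funs n. \<forall>f2\<in>funs n.
          measure_pmf.prob (coins P) {w. exec_output P f1 f2 w = Pre (fun_sum K n f1 f2)} \<ge> 1 - \<gamma>) \<longrightarrow>
       real k + real q * log 2 (real n) \<ge> c * \<alpha>^2 * (1 - \<gamma>) * real n)"
proof (intro exI[of _ "1 / 100"] conjI allI impI)
  fix n s q k :: nat and \<alpha> \<gamma> :: real and Pre :: "(nat \<Rightarrow> nat) \<Rightarrow> bool list"
    and Dec :: "nat \<Rightarrow> bool list \<Rightarrow> oracle_alg" and K :: "nat monoid"
    and P :: "(nat \<Rightarrow> nat, bool list) rand_protocol"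
  assume n: "n \<ge> 1" and pos: "0 < real k + real q * log 2 (real n)"
    and inv: "inversion_algorithm n s q Pre Dec"
    and \<alpha>: "0 \<le> \<alpha>" "inversion_prob n Pre Dec \<ge> \<alpha>"
    and K: "comm_group K" "carrier K = {1..n}"
    and k: "comm_complexity (funs n) P = k" and \<gamma>: "0 \<le> \<gamma>"
    and P: "\<forall>f1\<in>funs n. \<forall>f2\<in>funs n.
      measure_pmf.prob (coins P) {w. exec_output P f1 f2 w = Pre (fun_sum K n f1 f2)} \<ge> 1 - \<gamma>"
  let ?X = "real k + real q * log 2 (real n)"
  consider "\<gamma> > 1" | "\<gamma> \<le> 1" "n = 1" | "\<gamma> \<le> 1" "n \<ge> 2" using n by linarith
  then show "?X \<ge> 1 / 100 * \<alpha>\<^sup>2 * (1 - \<gamma>) * real n"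
  proof cases
    case 1
    then have "1 / 100 * \<alpha>\<^sup>2 * (1 - \<gamma>) * real n \<le> 0"
      by (intro mult_nonpos_nonneg mult_nonneg_nonpos) auto
    with pos show ?thesis by linarith
  next
    case 2
    \<comment> \<open>For \<open>n = 1\<close> the logarithm vanishes, so \<open>pos\<close> forces
      \<open>k \<ge> 1\<close>, while the bound to be reached is at most
      \<open>1 / 100\<close>.\<close>
    have "inversion_prob n Pre Dec \<le> 1" unfolding inversion_prob_def by (rule measure_pmf.prob_le_1)
    then have "\<alpha>\<^sup>2 \<le> 1" using \<alpha> by (simp add: power_le_one)
    then have "\<alpha>\<^sup>2 * (1 - \<gamma>) \<le> 1 * 1" using 2 \<gamma> by (intro mult_mono) auto
    moreover have "real k \<ge> 1" using pos 2 by simp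
    ultimately show ?thesis using 2 by simp
  next
    case 3
    have "log 2 n \<ge> 1" using 3 by simp
    \<comment> \<open>Since \<open>k\<close> and \<open>q\<close> are integers and
      \<open>log 2 n \<ge> 1\<close>, positivity already gives 1; this absorbs the additive constant
      of the transcript bound.\<close>
    have "?X \<ge> 1"
    proof (cases "k = 0")
      case True
      with pos have "real q \<ge> 1" by (cases q) auto
      then have "1 * 1 \<le> real q * log 2 n" using \<open>log 2 n \<ge> 1\<close> by (intro mult_mono) auto
      then show ?thesis by simp
    next
      case False
      then have "real k \<ge> 1" by simp
      moreover have "real q * log 2 n \<ge> 0" using \<open>log 2 n \<ge> 1\<close> by simp
      ultimately show ?thesis by linarith
    qed
    have "\<alpha>\<^sup>2 * (1 - \<gamma>) * n \<le> 2 * (2 + 12 * ln (real (3 ^ k * (n\<^sup>2 + 1) ^ q)))"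
      by (rule advantage_le[OF n inv \<alpha> K k 3(1) P])
    also have "\<dots> \<le> 2 * (2 + 12 * (3 * ?X))"
      by (intro mult_left_mono add_left_mono ln_card_transcripts_le 3) simp_all
    \<comment> \<open>The left side is \<open>4 + 72 * ?X\<close>, hence at most
      \<open>76 * ?X\<close>; the constant \<open>1 / 100\<close> leaves slack.\<close>
    also have "\<dots> \<le> 100 * ?X" using \<open>?X \<ge> 1\<close> by (simp add: algebra_simps)
    finally show ?thesis by simp
  qed
qed simp

end
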